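(* For every $n\geq 2$, the universal positive Toeplitz matrix $T_n$, given by $T_n(z)=[z^{k-j}]_{k,j=1}^n$ for $z\in S^1$, is pure and entangled in $\left(C(S^1)_{(n)}\otimes_{\rm min}\mathcal M_n(\mathbb C)\right)_+$.
   Context: $S^1\subset\mathbb C$ is the unit circle. $C(S^1)_{(n)}$ is the operator system of all functions $f:S^1\to\mathbb C$ of the form $f(z)=\sum_{k=-n+1}^{n-1}\alpha_kz^k$ with $\alpha_k\in\mathbb C$, regarded as an operator subsystem of the C$^*$-algebra $C(S^1)$ of continuous functions on $S^1$, with the constant function $1$ as order unit. Elements of $C(S^1)_{(n)}\otimes_{\rm min}\mathcal M_n(\mathbb C)$ are identified with functions $F:S^1\to\mathcal M_n(\mathbb C)$ of the form $F(z)=\sum_{\ell=-n+1}^{n-1}z^\ell\tau_\ell$, $\tau_\ell\in\mathcal M_n(\mathbb C)$, and $F$ is positive iff $F(z)$ is positive semidefinite for every $z\in S^1$ (here $\otimes_{\rm min}$ is the spatial operator system tensor product). A positive element $x$ of $\mathcal R\otimes_{\rm min}\mathcal S$ ($\mathcal R,\mathcal S$ operator systems) is separable if $x=\sum_{j=1}^m r_j\otimes s_j$ for some positive $r_j\in\mathcal R$ and positive $s_j\in\mathcal S$; otherwise the positive element $x$ is entangled. An element $\phi$ of a convex cone $\mathcal C$ is pure if the equation $\vartheta+\omega=\phi$, with $\vartheta,\omega\in\mathcal C$, holds only if there is a scalar $s\in[0,1]$ with $\vartheta=s\phi$ and $\omega=(1-s)\phi$. *)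

theory Defs
  imports
    "HOL-Analysis.Elementary_Metric_Spaces"
    "HOL-Library.FuncSet"
    "HOL-Library.Complex_Order"
    "Jordan_Normal_Form.Matrix"
begin

text \<open>
  Functions on the unit circle are the functions on \<^term>\<open>sphere (0::complex) 1\<close> that are
  extensional, i.e. \<^const>\<open>undefined\<close> off the circle, so that equality of such functions is
  equality on the circle. The order on \<^typ>\<open>complex\<close> is the one of
  \<open>HOL-Library.Complex_Order\<close>: \<^prop>\<open>0 \<le> w\<close> means that \<open>w\<close> is real and non-negative.
\<close>

abbreviation circle :: "complex set" where
  "circle \<equiv> sphere 0 1"

text \<open>Same construction as \<^const>\<open>finsum_vec\<close>; the summands must lie in
  \<^term>\<open>carrier_mat d d\<close>, and the empty sum is the zero matrix.\<close>

definition finsum_mat :: "nat \<Rightarrow> ('i \<Rightarrow> complex mat) \<Rightarrow> 'i set \<Rightarrow> complex mat" where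
  "finsum_mat d = finprod (monoid_mat TYPE(complex) d d)"

lemma finsum_mat_entries:
  assumes "finite I" and "\<And>i. i \<in> I \<Longrightarrow> f i \<in> carrier_mat d d"
  shows "finsum_mat d f I = mat d d (\<lambda>(a, b). \<Sum>i\<in>I. f i $$ (a, b))"
  using assms
proof (induction I rule: finite_induct)
  case empty
  interpret M: comm_monoid "monoid_mat TYPE(complex) d d" by (rule comm_monoid_mat)
  show ?case
    unfolding finsum_mat_def M.finprod_empty by (auto simp: monoid_mat_def)
next
  case (insert i I)
  interpret M: comm_monoid "monoid_mat TYPE(complex) d d" by (rule comm_monoid_mat)
  have "finsum_mat d f (insert i I) = f i + finsum_mat d f I"
    unfolding finsum_mat_def using insert
    by (subst M.finprod_insert) (auto simp: monoid_mat_def)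
  moreover have "f i \<in> carrier_mat d d"
    using insert by simp
  ultimately show ?case
    using insert by auto
qed

text \<open>No separate hermitian condition is needed: over the complex numbers it follows from
  \<open>v\<^sup>* A v\<close> being real for all \<open>v\<close>.\<close>

definition psd_matrices :: "nat \<Rightarrow> complex mat set" where
  "psd_matrices d =
     {A \<in> carrier_mat d d. \<forall>v \<in> carrier_vec d. 0 \<le> (A *\<^sub>v v) \<bullet>c v}"

text \<open>The operator system of trigonometric polynomials of degree less than \<open>n\<close>, and its
  positive elements.\<close>

definition trig_system :: "nat \<Rightarrow> (complex \<Rightarrow> complex) set" where
  "trig_system n =
     {f \<in> extensional circle.
        \<exists>\<alpha> :: int \<Rightarrow> complex. \<forall>z \<in> circle.
          f z = (\<Sum>k = - int n + 1..int n - 1. \<alpha> k * z powi k)}"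

definition trig_system_pos :: "nat \<Rightarrow> (complex \<Rightarrow> complex) set" where
  "trig_system_pos n = {f \<in> trig_system n. \<forall>z \<in> circle. 0 \<le> f z}"

text \<open>The minimal tensor product of \<^term>\<open>trig_system n\<close> with the \<open>d \<times> d\<close> matrices, realised
  inside the matrix-valued functions on the circle, and its positive cone.\<close>

definition trig_mat_system :: "nat \<Rightarrow> nat \<Rightarrow> (complex \<Rightarrow> complex mat) set" where
  "trig_mat_system n d =
     {F \<in> extensional circle.
        \<exists>\<tau> :: int \<Rightarrow> complex mat. range \<tau> \<subseteq> carrier_mat d d \<and>
          (\<forall>z \<in> circle.
             F z = finsum_mat d (\<lambda>l. (z powi l) \<cdot>\<^sub>m \<tau> l) {- int n + 1..int n - 1})}"

definition trig_mat_cone :: "nat \<Rightarrow> nat \<Rightarrow> (complex \<Rightarrow> complex mat) set" where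
  "trig_mat_cone n d = {F \<in> trig_mat_system n d. \<forall>z \<in> circle. F z \<in> psd_matrices d}"

definition mfun_add ::
  "(complex \<Rightarrow> complex mat) \<Rightarrow> (complex \<Rightarrow> complex mat) \<Rightarrow> complex \<Rightarrow> complex mat" where
  "mfun_add F G = (\<lambda>z\<in>circle. F z + G z)"

definition mfun_scale :: "real \<Rightarrow> (complex \<Rightarrow> complex mat) \<Rightarrow> complex \<Rightarrow> complex mat" where
  "mfun_scale s F = (\<lambda>z\<in>circle. complex_of_real s \<cdot>\<^sub>m F z)"

definition mfun_sum ::
  "nat \<Rightarrow> ('i \<Rightarrow> complex \<Rightarrow> complex mat) \<Rightarrow> 'i set \<Rightarrow> complex \<Rightarrow> complex mat" where
  "mfun_sum d F I = (\<lambda>z\<in>circle. finsum_mat d (\<lambda>i. F i z) I)"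

text \<open>Under the identification with matrix-valued functions, \<open>r \<otimes> s\<close> is \<open>z \<mapsto> r(z) s\<close>.\<close>

definition elem_tensor :: "(complex \<Rightarrow> complex) \<Rightarrow> complex mat \<Rightarrow> complex \<Rightarrow> complex mat" where
  "elem_tensor r s = (\<lambda>z\<in>circle. r z \<cdot>\<^sub>m s)"

definition separable :: "nat \<Rightarrow> nat \<Rightarrow> (complex \<Rightarrow> complex mat) \<Rightarrow> bool" where
  "separable n d F \<longleftrightarrow>
     F \<in> trig_mat_cone n d \<and>
     (\<exists>(m::nat) r s.
        (\<forall>j \<in> {1..m}. r j \<in> trig_system_pos n \<and> s j \<in> psd_matrices d) \<and>
        F = mfun_sum d (\<lambda>j. elem_tensor (r j) (s j)) {1..m})"

definition entangled :: "nat \<Rightarrow> nat \<Rightarrow> (complex \<Rightarrow> complex mat) \<Rightarrow> bool" where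
  "entangled n d F \<longleftrightarrow> F \<in> trig_mat_cone n d \<and> \<not> separable n d F"

text \<open>Purity in a convex cone \<open>C\<close>, with the addition and the real scalar multiplication of the
  ambient vector space passed explicitly because it is given by carriers.\<close>

definition pure_in_cone ::
  "('v \<Rightarrow> 'v \<Rightarrow> 'v) \<Rightarrow> (real \<Rightarrow> 'v \<Rightarrow> 'v) \<Rightarrow> 'v set \<Rightarrow> 'v \<Rightarrow> bool" where
  "pure_in_cone vadd vscale C \<phi> \<longleftrightarrow>
     \<phi> \<in> C \<and>
     (\<forall>\<theta> \<in> C. \<forall>\<omega> \<in> C. vadd \<theta> \<omega> = \<phi> \<longrightarrow>
        (\<exists>s \<in> {0..1}. \<theta> = vscale s \<phi> \<and> \<omega> = vscale (1 - s) \<phi>))"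

text \<open>Rows \<open>k\<close> and columns \<open>j\<close> are numbered from \<open>0\<close>, which leaves \<open>k - j\<close> unchanged.\<close>

definition toeplitz :: "nat \<Rightarrow> complex \<Rightarrow> complex mat" where
  "toeplitz n = (\<lambda>z\<in>circle. mat n n (\<lambda>(k, j). z powi (int k - int j)))"

end

theory Submission
  imports Defs
begin

text \<open>
  For \<open>|z| = 1\<close> the matrix \<open>T\<^sub>n(z) = v v\<^sup>*\<close> with \<open>v = (1, z, \<dots>, z\<^sup>n\<^sup>-\<^sup>1)\<close> has rank one, so
  every matrix between \<open>0\<close> and \<open>T\<^sub>n(z)\<close> is a multiple \<open>s(z) T\<^sub>n(z)\<close>.
  If the multiple comes from an element of the cone, then \<open>s(z)\<close>, \<open>z\<^sup>n\<^sup>-\<^sup>1 s(z)\<close> and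
  \<open>z\<^sup>1\<^sup>-\<^sup>n s(z)\<close> are matrix entries, hence all trigonometric polynomials of degree less than
  \<open>n\<close>; this forces \<open>s\<close> to be constant, which is purity.
  In a separable decomposition, a term \<open>r \<otimes> s\<close> that does not vanish at \<open>1\<close> has \<open>s\<close> proportional
  to \<open>T\<^sub>n(1)\<close>, so it cannot be proportional to \<open>T\<^sub>n(z)\<close> for \<open>z \<noteq> 1\<close> unless \<open>r(z) = 0\<close>;
  but a trigonometric polynomial vanishing on the circle minus a point is zero.
\<close>

section \<open>Positive semidefinite forms\<close>

text \<open>Index functions replace matrices and vectors, so the linear algebra below is free of
  carrier conditions; only indices below \<open>d\<close> count. The form is linear in
  \<open>x\<close> and conjugate-linear in \<open>y\<close>, matching
  \<open>\<bullet>c\<close>.\<close>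

definition sesq :: "nat \<Rightarrow> (nat \<Rightarrow> nat \<Rightarrow> complex) \<Rightarrow> (nat \<Rightarrow> complex) \<Rightarrow> (nat \<Rightarrow> complex) \<Rightarrow> complex" where
  "sesq d A x y = (\<Sum>k<d. \<Sum>j<d. A k j * x j * cnj (y k))"

definition psd_form :: "nat \<Rightarrow> (nat \<Rightarrow> nat \<Rightarrow> complex) \<Rightarrow> bool" where
  "psd_form d A \<longleftrightarrow> (\<forall>x. 0 \<le> sesq d A x x)"

lemma sesq_matrix:
  assumes "A \<in> carrier_mat d d"
  shows "(A *\<^sub>v vec d x) \<bullet>c vec d y = sesq d (\<lambda>k j. A $$ (k, j)) x y"
  using assms
  by (simp add: sesq_def scalar_prod_def sum_distrib_right lessThan_atLeast0)

lemma psd_matrices_iff: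
  "A \<in> psd_matrices d \<longleftrightarrow> A \<in> carrier_mat d d \<and> psd_form d (\<lambda>k j. A $$ (k, j))"
proof (cases "A \<in> carrier_mat d d")
  case A: True
  have "(\<forall>v \<in> carrier_vec d. 0 \<le> (A *\<^sub>v v) \<bullet>c v) \<longleftrightarrow>
        (\<forall>x. 0 \<le> (A *\<^sub>v vec d x) \<bullet>c vec d x)"
  proof (intro iffI allI ballI)
    fix v :: "complex vec" assume *: "\<forall>x. 0 \<le> (A *\<^sub>v vec d x) \<bullet>c vec d x"
      and v: "v \<in> carrier_vec d"
    have "v = vec d (\<lambda>i. v $ i)" using v by auto
    with * show "0 \<le> (A *\<^sub>v v) \<bullet>c v" by metis
  qed auto
  with A show ?thesis
    by (simp add: psd_matrices_def psd_form_def sesq_matrix)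
qed (simp add: psd_matrices_def)

lemma sesq_add_left: "sesq d A (\<lambda>i. x i + y i) w = sesq d A x w + sesq d A y w"
  by (simp add: sesq_def algebra_simps sum.distrib)

lemma sesq_add_right: "sesq d A w (\<lambda>i. x i + y i) = sesq d A w x + sesq d A w y"
  by (simp add: sesq_def algebra_simps sum.distrib)

lemma sesq_scale_left: "sesq d A (\<lambda>i. t * x i) w = t * sesq d A x w"
  by (simp add: sesq_def sum_distrib_left algebra_simps)

lemma sesq_scale_right: "sesq d A w (\<lambda>i. t * x i) = cnj t * sesq d A w x"
  by (simp add: sesq_def sum_distrib_left algebra_simps)

lemmas sesq_linear = sesq_add_left sesq_add_right sesq_scale_left sesq_scale_right

lemma sesq_sum:
  assumes "finite J"
  shows "sesq d (\<lambda>k j. \<Sum>i\<in>J. A i k j) x y = (\<Sum>i\<in>J. sesq d (A i) x y)"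
  using assms
  by (induction rule: finite_induct) (simp_all add: sesq_def algebra_simps sum.distrib)

lemma sesq_scale_form: "sesq d (\<lambda>k j. c * A k j) x y = c * sesq d A x y"
  by (simp add: sesq_def sum_distrib_left algebra_simps)

lemma sum_mult_unit:
  fixes f :: "nat \<Rightarrow> 'a :: semiring_1"
  assumes "j < d"
  shows "(\<Sum>i<d. f i * of_bool (i = j)) = f j"
proof -
  have "(\<Sum>i<d. f i * of_bool (i = j)) = (\<Sum>i<d. if i = j then f i else 0)"
    by (intro sum.cong) auto
  with assms show ?thesis by simp
qed

lemma cnj_of_bool: "cnj (of_bool P) = of_bool P"
  by (cases P) auto

lemma sesq_unit:
  assumes "k < d" "j < d"
  shows "sesq d A (\<lambda>i. of_bool (i = j)) (\<lambda>i. of_bool (i = k)) = A k j"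
  using assms by (simp add: sesq_def sum_distrib_right[symmetric] sum_mult_unit cnj_of_bool)

lemma sesq_rank_one:
  "sesq d (\<lambda>k j. v k * cnj (v j)) x y = (\<Sum>j<d. cnj (v j) * x j) * (\<Sum>k<d. v k * cnj (y k))"
  unfolding sesq_def sum_product by (subst sum.swap) (simp add: algebra_simps)

lemma psd_form_rank_one: "psd_form d (\<lambda>k j. v k * cnj (v j))"
proof -
  have "sesq d (\<lambda>k j. v k * cnj (v j)) x x
      = (\<Sum>j<d. cnj (v j) * x j) * cnj (\<Sum>j<d. cnj (v j) * x j)" for x
    by (simp add: sesq_rank_one)
  moreover have "0 \<le> w * cnj w" for w
    by (simp add: less_eq_complex_def)
  ultimately show ?thesis
    by (simp only: psd_form_def) blast
qed

lemma psd_form_diag: "psd_form d A \<Longrightarrow> k < d \<Longrightarrow> 0 \<le> A k k"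
  by (metis psd_form_def sesq_unit)

lemma psd_form_sum:
  assumes "finite J" "\<And>i. i \<in> J \<Longrightarrow> psd_form d (A i)"
  shows "psd_form d (\<lambda>k j. \<Sum>i\<in>J. A i k j)"
  using assms by (auto simp: psd_form_def sesq_sum intro: sum_nonneg)

lemma psd_form_scale:
  assumes "0 \<le> c" "psd_form d A"
  shows "psd_form d (\<lambda>k j. c * A k j)"
  using assms by (auto simp: psd_form_def sesq_scale_form intro: mult_nonneg_nonneg)

text \<open>Near \<open>t = 0\<close> the linear term dominates and changes sign with
  \<open>t\<close>.\<close>

lemma linear_term_zero:
  fixes b c :: real
  assumes "\<And>t. 0 \<le> t * b + t\<^sup>2 * c"
  shows "b = 0"
proof (rule ccontr)
  assume b: "b \<noteq> 0"
  obtain D where D: "D > 0" "D > c"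
    using that[of "\<bar>c\<bar> + 1"] by auto
  \<comment> \<open>With \<open>D\<close> positive and larger than \<open>c\<close>, the choice
    \<open>t = - b / D\<close> already gives a negative value.\<close>
  have "(- b / D) * b + (- b / D)\<^sup>2 * c = (b / D)\<^sup>2 * (c - D)"
    using D(1) by (simp add: field_simps power2_eq_square)
  moreover have "\<dots> < 0"
    using b D by (intro mult_pos_neg) auto
  ultimately show False using assms[of "- b / D"] by simp
qed

text \<open>An isotropic vector of a positive form lies in its kernel: the form at
  \<open>x + t y\<close> has no constant term in \<open>t\<close>, so positivity forces the linear
  term to vanish. Hermitian symmetry is not assumed, hence one conclusion for each argument.\<close>

lemma psd_form_kernel:
  assumes A: "psd_form d A" and x: "sesq d A x x = 0"
  shows "sesq d A x y = 0" and "sesq d A y x = 0"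
proof -
  let ?p = "sesq d A x y" and ?q = "sesq d A y x"
  have pos: "0 \<le> cnj t * ?p + t * ?q + t * cnj t * sesq d A y y" for t
  proof -
    have "0 \<le> sesq d A (\<lambda>i. x i + t * y i) (\<lambda>i. x i + t * y i)"
      using A by (simp add: psd_form_def)
    then show ?thesis unfolding sesq_linear x by (simp add: algebra_simps)
  qed
  have im: "Im (sesq d A y y) = 0"
    using A by (simp add: psd_form_def less_eq_complex_def)
  \<comment> \<open>Real parts along the real and the imaginary axis give two inequalities for
    \<open>linear_term_zero\<close>; imaginary parts at \<open>1\<close> and \<open>\<i>\<close>
    give two equations. Together they determine both complex unknowns.\<close>
  have 1: "0 \<le> t * Re (?p + ?q) + t\<^sup>2 * Re (sesq d A y y)" for t
    using pos[of "of_real t"] by (simp add: less_eq_complex_def power2_eq_square algebra_simps)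
  have 2: "0 \<le> t * (Im ?p - Im ?q) + t\<^sup>2 * Re (sesq d A y y)" for t
    using pos[of "of_real t * \<i>"] by (simp add: less_eq_complex_def power2_eq_square algebra_simps)
  have 3: "Im ?p + Im ?q = 0"
    using pos[of 1] im by (simp add: less_eq_complex_def)
  have 4: "Re ?q - Re ?p = 0"
    using pos[of \<i>] im by (simp add: less_eq_complex_def)
  show "?p = 0" "?q = 0"
    using linear_term_zero[OF 1] linear_term_zero[OF 2] 3 4 by (simp_all add: complex_eq_iff)
qed

text \<open>Vectors orthogonal to \<open>v\<close> are isotropic for \<open>A + B\<close>, hence for
  \<open>A\<close>, hence in the kernel of \<open>A\<close>. This leaves \<open>A\<close> only its
  multiple of the rank-one form, and \<open>v 0 = 1\<close> makes the corner entry the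
  factor.\<close>

lemma psd_form_below_rank_one:
  assumes A: "psd_form d A" and B: "psd_form d B"
    and AB: "\<And>k j. k < d \<Longrightarrow> j < d \<Longrightarrow> A k j + B k j = v k * cnj (v j)"
    and v0: "v 0 = 1" and k: "k < d" and j: "j < d"
  shows "A k j = A 0 0 * (v k * cnj (v j))"
proof -
  have d: "0 < d" using k by simp
  \<comment> \<open>\<open>x i\<close> is the \<open>i\<close>-th unit vector minus its component
    along \<open>v\<close>, removed by means of the unit vector at \<open>0\<close>;
    \<open>v 0 = 1\<close> makes it orthogonal to \<open>v\<close>.\<close>
  define x where "x i = (\<lambda>l. of_bool (l = i) + (- cnj (v i)) * of_bool (l = (0::nat)))" for i
  have null: "sesq d A (x i) (x i) = 0" if i: "i < d" for i
  proof -
    have "(\<Sum>l<d. cnj (v l) * x i l) = 0"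
      using i d v0 by (simp add: x_def right_diff_distrib sum_subtractf sum_mult_unit mult.assoc[symmetric])
    then have "sesq d (\<lambda>k j. v k * cnj (v j)) (x i) (x i) = 0"
      by (simp add: sesq_rank_one)
    also have "sesq d (\<lambda>k j. v k * cnj (v j)) (x i) (x i)
        = sesq d A (x i) (x i) + sesq d B (x i) (x i)"
      by (simp add: sesq_def AB[symmetric] algebra_simps sum.distrib)
    finally show ?thesis
      using A B by (metis add_nonneg_eq_0_iff psd_form_def)
  qed
  have right: "A l i = A l 0 * cnj (v i)" if "l < d" "i < d" for l i
    using psd_form_kernel(1)[OF A null[OF \<open>i < d\<close>], of "\<lambda>m. of_bool (m = l)"] that d
    unfolding x_def sesq_linear by (simp add: sesq_unit algebra_simps)
  have left: "A i l = v i * A 0 l" if "l < d" "i < d" for l i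
    using psd_form_kernel(2)[OF A null[OF \<open>i < d\<close>], of "\<lambda>m. of_bool (m = l)"] that d
    unfolding x_def sesq_linear by (simp add: sesq_unit algebra_simps)
  show ?thesis
    using right[OF k j] left[OF d k] by (simp add: algebra_simps)
qed

section \<open>Trigonometric polynomials\<close>

lemma infinite_circle: "infinite circle"
proof
  assume fin: "finite circle"
  have "inj_on cis {0<..<pi}"
    by (intro inj_onI) (auto simp: complex_eq_iff intro: cos_inj_pi)
  moreover have "cis ` {0<..<pi} \<subseteq> circle" by auto
  ultimately have "finite {0<..<pi}"
    using fin by (meson finite_imageD finite_subset)
  then show False by (simp add: infinite_Ioo)
qed

text \<open>Multiplication by a high power of \<open>z\<close> turns the Laurent polynomial into a
  polynomial with infinitely many roots.\<close>

lemma laurent_coeffs_zero: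
  fixes a :: "int \<Rightarrow> complex"
  assumes S: "infinite S" "0 \<notin> S" and K: "finite K"
    and zero: "\<And>z. z \<in> S \<Longrightarrow> (\<Sum>k\<in>K. a k * z powi k) = 0"
    and k: "k \<in> K"
  shows "a k = 0"
proof -
  define N where "N = Max (insert k ((\<lambda>k. \<bar>k\<bar>) ` K))"
  have N: "\<bar>l\<bar> \<le> N" if "l \<in> K" for l
    unfolding N_def using that K by (intro Max_ge) auto
  \<comment> \<open>\<open>c i\<close> is the coefficient of \<open>z ^ i\<close> after
    multiplication by \<open>z powi N\<close>; exponents then lie between \<open>0\<close> and
    \<open>2 * N\<close>.\<close>
  define c where "c i = (if int i - N \<in> K then a (int i - N) else 0)" for i
  define M where "M = nat (2 * N)"
  have poly: "(\<Sum>i\<le>M. c i * z ^ i) = z powi N * (\<Sum>k\<in>K. a k * z powi k)" if "z \<noteq> 0" for z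
  proof -
    have "(\<Sum>i\<le>M. c i * z ^ i) = (\<Sum>i\<in>{i\<in>{..M}. int i - N \<in> K}. a (int i - N) * z ^ i)"
      unfolding c_def by (subst sum.inter_filter) (auto intro!: sum.cong)
    also have "\<dots> = (\<Sum>k\<in>K. a k * z ^ nat (k + N))"
      by (rule sum.reindex_bij_witness[of _ "\<lambda>k. nat (k + N)" "\<lambda>i. int i - N"])
        (use N in \<open>auto simp: M_def abs_le_iff nat_le_iff dest!: N\<close>)
    also have "\<dots> = (\<Sum>k\<in>K. z powi N * (a k * z powi k))"
    proof (rule sum.cong)
      fix l assume "l \<in> K"
      then have "z ^ nat (l + N) = z powi (l + N)"
        using N[of l] by (simp add: power_int_def)
      then show "a l * z ^ nat (l + N) = z powi N * (a l * z powi l)"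
        using that by (simp add: power_int_add)
    qed simp
    finally show ?thesis by (simp add: sum_distrib_left)
  qed
  have "S \<subseteq> {z. (\<Sum>i\<le>M. c i * z ^ i) = 0}"
  proof
    fix z assume z: "z \<in> S"
    then have "z \<noteq> 0" using S(2) by blast
    then show "z \<in> {z. (\<Sum>i\<le>M. c i * z ^ i) = 0}"
      by (simp add: poly zero[OF z])
  qed
  then have "infinite {z. (\<Sum>i\<le>M. c i * z ^ i) = 0}"
    using S(1) finite_subset by blast
  then have "c (nat (k + N)) = 0"
    using polyfun_finite_roots[of c M] N[OF k] by (auto simp: M_def)
  moreover have "int (nat (k + N)) - N = k"
    using N[OF k] by simp
  ultimately show ?thesis
    using k by (simp only: c_def if_True)
qed

text \<open>The shift by \<open>q\<close> carries the coefficient at \<open>k\<close> to an exponent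
  that is absent from the right-hand side.\<close>

lemma laurent_shift_coeff_zero:
  fixes \<alpha> \<beta> :: "int \<Rightarrow> complex"
  assumes I: "finite I"
    and eq: "\<And>z. z \<in> circle \<Longrightarrow>
      (\<Sum>k\<in>I. \<alpha> k * z powi k) * z powi q = (\<Sum>k\<in>I. \<beta> k * z powi k)"
    and k: "k \<in> I" "k + q \<notin> I"
  shows "\<alpha> k = 0"
proof -
  let ?J = "(\<lambda>k. k + q) ` I"
  \<comment> \<open>Coefficients of left side minus right side over the union of both exponent
    sets.\<close>
  define a where "a l = (if l \<in> ?J then \<alpha> (l - q) else 0) - (if l \<in> I then \<beta> l else 0)" for l
  have "a (k + q) = 0"
  proof (rule laurent_coeffs_zero[OF infinite_circle])
    show "finite (?J \<union> I)" using I by simp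
    fix z :: complex assume z: "z \<in> circle"
    then have z0: "z \<noteq> 0" by auto
    have "(\<Sum>l\<in>?J \<union> I. a l * z powi l)
        = (\<Sum>l\<in>?J \<union> I. if l \<in> ?J then \<alpha> (l - q) * z powi l else 0)
          - (\<Sum>l\<in>?J \<union> I. if l \<in> I then \<beta> l * z powi l else 0)"
      unfolding a_def sum_subtractf[symmetric]
      by (intro sum.cong) (auto simp: algebra_simps)
    also have "\<dots> = (\<Sum>l\<in>?J. \<alpha> (l - q) * z powi l) - (\<Sum>l\<in>I. \<beta> l * z powi l)"
      using I by (simp add: sum.inter_restrict[symmetric])
    also have "(\<Sum>l\<in>?J. \<alpha> (l - q) * z powi l) = (\<Sum>k\<in>I. \<alpha> k * z powi k) * z powi q"
      using z0 by (simp add: sum.reindex sum_distrib_right power_int_add mult.assoc)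
    finally show "(\<Sum>l\<in>?J \<union> I. a l * z powi l) = 0"
      using eq[OF z] by simp
  qed (use k in auto)
  then show ?thesis using k by (simp add: a_def)
qed

section \<open>The universal Toeplitz matrix\<close>

lemma trig_mat_system_entries:
  assumes "F \<in> trig_mat_system n d"
  obtains \<alpha> :: "nat \<Rightarrow> nat \<Rightarrow> int \<Rightarrow> complex" where
    "\<And>z a b. z \<in> circle \<Longrightarrow> a < d \<Longrightarrow> b < d \<Longrightarrow>
       F z $$ (a, b) = (\<Sum>k = - int n + 1..int n - 1. \<alpha> a b k * z powi k)"
proof -
  obtain \<tau> :: "int \<Rightarrow> complex mat" where \<tau>: "range \<tau> \<subseteq> carrier_mat d d"
    and F: "\<And>z. z \<in> circle \<Longrightarrow>
      F z = finsum_mat d (\<lambda>l. (z powi l) \<cdot>\<^sub>m \<tau> l) {- int n + 1..int n - 1}"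
    using assms by (auto simp: trig_mat_system_def)
  have car: "\<tau> l \<in> carrier_mat d d" for l using \<tau> by auto
  show thesis
  proof
    fix z :: complex and a b assume "z \<in> circle" "a < d" "b < d"
    then show "F z $$ (a, b) =
        (\<Sum>k = - int n + 1..int n - 1. (\<lambda>a b k. \<tau> k $$ (a, b)) a b k * z powi k)"
      using car carrier_matD[OF car] by (simp add: F finsum_mat_entries mult.commute)
  qed
qed

lemma circle_powi_diff:
  assumes "z \<in> circle"
  shows "z powi (int k - int j) = z ^ k * cnj (z ^ j)"
proof -
  have "z * cnj z = 1"
    using assms complex_norm_square[of z] by simp
  then have "cnj z = inverse z"
    by (simp add: inverse_unique)
  moreover have "z \<noteq> 0" using assms by auto
  ultimately show ?thesis
    by (simp add: power_int_diff divide_inverse power_inverse)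
qed

lemma toeplitz_entry:
  assumes "z \<in> circle" "k < n" "j < n"
  shows "toeplitz n z $$ (k, j) = z ^ k * cnj (z ^ j)"
  using assms circle_powi_diff[OF assms(1)] by (simp add: toeplitz_def)

lemma toeplitz_in_cone: "toeplitz n \<in> trig_mat_cone n n"
proof -
  \<comment> \<open>\<open>\<tau> l\<close> has ones exactly where row minus column equals
    \<open>l\<close>; all such differences have absolute value below \<open>n\<close>.\<close>
  define \<tau> where "\<tau> l = mat n n (\<lambda>(k, j). of_bool (int k - int j = l) :: complex)" for l
  have "toeplitz n z = finsum_mat n (\<lambda>l. (z powi l) \<cdot>\<^sub>m \<tau> l) {- int n + 1..int n - 1}"
    if z: "z \<in> circle" for z
    using z
    by (subst finsum_mat_entries)
      (auto intro!: eq_matI simp: toeplitz_def \<tau>_def of_bool_def if_distrib cong: if_cong)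
  then have "toeplitz n \<in> trig_mat_system n n"
    by (auto simp: trig_mat_system_def toeplitz_def \<tau>_def intro!: exI[of _ \<tau>])
  moreover have "toeplitz n z \<in> psd_matrices n" if z: "z \<in> circle" for z
  proof -
    have "sesq n (\<lambda>k j. toeplitz n z $$ (k, j)) x x = sesq n (\<lambda>k j. z ^ k * cnj (z ^ j)) x x" for x
      unfolding sesq_def using toeplitz_entry[OF z] by (intro sum.cong) auto
    then show ?thesis
      using z psd_form_rank_one[of n "\<lambda>k. z ^ k"]
      by (simp add: psd_matrices_iff psd_form_def) (simp add: toeplitz_def)
  qed
  ultimately show ?thesis by (simp add: trig_mat_cone_def)
qed

section \<open>Purity of the Toeplitz matrix\<close>

lemma toeplitz_pure:
  assumes n: "n \<ge> 1"
  shows "pure_in_cone mfun_add mfun_scale (trig_mat_cone n n) (toeplitz n)"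
  unfolding pure_in_cone_def
proof (intro conjI ballI impI toeplitz_in_cone)
  fix \<theta> \<omega>
  assume \<theta>: "\<theta> \<in> trig_mat_cone n n" and \<omega>: "\<omega> \<in> trig_mat_cone n n"
    and sum: "mfun_add \<theta> \<omega> = toeplitz n"
  have car: "\<theta> z \<in> carrier_mat n n" "\<omega> z \<in> carrier_mat n n"
    and psd: "psd_form n (\<lambda>k j. \<theta> z $$ (k, j))" "psd_form n (\<lambda>k j. \<omega> z $$ (k, j))"
    if "z \<in> circle" for z
    using \<theta> \<omega> that by (auto simp: trig_mat_cone_def psd_matrices_iff)
  have ext: "\<theta> \<in> extensional circle" "\<omega> \<in> extensional circle"
    using \<theta> \<omega> by (auto simp: trig_mat_cone_def trig_mat_system_def)
  have add: "\<theta> z $$ (k, j) + \<omega> z $$ (k, j) = z ^ k * cnj (z ^ j)"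
    if "z \<in> circle" "k < n" "j < n" for z k j
    using fun_cong[OF sum, of z] that car[OF that(1)] toeplitz_entry[OF that]
    by (simp add: mfun_add_def index_add_mat[symmetric] del: index_add_mat)
  have multiple: "\<theta> z $$ (k, j) = \<theta> z $$ (0, 0) * (z ^ k * cnj (z ^ j))"
    if "z \<in> circle" "k < n" "j < n" for z k j
    using add[OF that(1)] by (intro psd_form_below_rank_one[OF psd[OF that(1)] _ _ that(2,3)]) auto
  obtain \<alpha> where \<alpha>: "\<And>z a b. z \<in> circle \<Longrightarrow> a < n \<Longrightarrow> b < n \<Longrightarrow>
       \<theta> z $$ (a, b) = (\<Sum>k = - int n + 1..int n - 1. \<alpha> a b k * z powi k)"
    using \<theta> trig_mat_system_entries unfolding trig_mat_cone_def by blast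
  let ?I = "{- int n + 1..int n - 1}"
  \<comment> \<open>The corner entry of \<open>\<theta>\<close>, multiplied by any
    \<open>z powi (a - b)\<close>, is again a matrix entry and so keeps its exponents in
    \<open>?I\<close>.\<close>
  have shift: "(\<Sum>k\<in>?I. \<alpha> 0 0 k * z powi k) * z powi (int a - int b)
      = (\<Sum>k\<in>?I. \<alpha> a b k * z powi k)" if "z \<in> circle" "a < n" "b < n" for z a b
    using multiple[OF that] n circle_powi_diff[OF that(1)] \<alpha>[OF that(1)] that by simp
  \<comment> \<open>The extreme shifts by \<open>n - 1\<close> and \<open>1 - n\<close> push every
    positive, respectively negative, exponent out of \<open>?I\<close>.\<close>
  have zero: "\<alpha> 0 0 k = 0" if k: "k \<in> ?I" "k \<noteq> 0" for k
  proof (cases "k > 0")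
    case True
    have "z \<in> circle \<Longrightarrow> (\<Sum>k\<in>?I. \<alpha> 0 0 k * z powi k) * z powi (int n - 1)
      = (\<Sum>k\<in>?I. \<alpha> (n - 1) 0 k * z powi k)" for z
      using shift[of z "n - 1" 0] n by simp
    then show ?thesis
      by (rule laurent_shift_coeff_zero[rotated]) (use True k in auto)
  next
    case False
    have "z \<in> circle \<Longrightarrow> (\<Sum>k\<in>?I. \<alpha> 0 0 k * z powi k) * z powi (1 - int n)
      = (\<Sum>k\<in>?I. \<alpha> 0 (n - 1) k * z powi k)" for z
      using shift[of z 0 "n - 1"] n by simp
    then show ?thesis
      by (rule laurent_shift_coeff_zero[rotated]) (use False k in auto)
  qed
  have const: "\<theta> z $$ (0, 0) = \<alpha> 0 0 0" if "z \<in> circle" for z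
  proof -
    have "(\<Sum>k\<in>?I. \<alpha> 0 0 k * z powi k) = (\<Sum>k\<in>{0}. \<alpha> 0 0 k * z powi k)"
      using n zero by (intro sum.mono_neutral_right) auto
    with \<alpha>[OF that, of 0 0] n show ?thesis by simp
  qed
  define s where "s = Re (\<alpha> 0 0 0)"
  have one: "(1::complex) \<in> circle" by simp
  \<comment> \<open>The corner entries of \<open>\<theta>\<close> and \<open>\<omega>\<close> at
    \<open>z = 1\<close> are non-negative and add up to \<open>1\<close>, so the constant is real
    and lies in \<open>[0, 1]\<close>.\<close>
  have "0 \<le> \<alpha> 0 0 0"
    using psd_form_diag[OF psd(1)[OF one], of 0] const[OF one] n by simp
  moreover have "0 \<le> 1 - \<alpha> 0 0 0"
  proof -
    have "\<omega> 1 $$ (0, 0) = 1 - \<alpha> 0 0 0"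
      using const[OF one] add[OF one, of 0 0] n by (simp add: eq_diff_eq add.commute)
    with psd_form_diag[OF psd(2)[OF one], of 0] n show ?thesis by (simp del: diff_ge_0_iff_ge)
  qed
  ultimately have s: "s \<in> {0..1}" "\<alpha> 0 0 0 = of_real s"
    by (auto simp: s_def less_eq_complex_def complex_eq_iff)
  have T: "toeplitz n z \<in> carrier_mat n n" if "z \<in> circle" for z
    using that by (simp add: toeplitz_def)
  have \<theta>s: "\<theta> z $$ (k, j) = of_real s * toeplitz n z $$ (k, j)"
    and \<omega>s: "\<omega> z $$ (k, j) = of_real (1 - s) * toeplitz n z $$ (k, j)"
    if "z \<in> circle" "k < n" "j < n" for z k j
    using multiple[OF that] add[OF that] const[OF that(1)] s(2) toeplitz_entry[OF that]
    by (simp_all add: algebra_simps)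
  have "\<theta> = mfun_scale s (toeplitz n)"
  proof (rule extensionalityI[OF ext(1)])
    fix z :: complex assume z: "z \<in> circle"
    show "\<theta> z = mfun_scale s (toeplitz n) z"
      using z car[OF z] T[OF z] \<theta>s[OF z] by (intro eq_matI) (auto simp: mfun_scale_def)
  qed (simp add: mfun_scale_def)
  moreover have "\<omega> = mfun_scale (1 - s) (toeplitz n)"
  proof (rule extensionalityI[OF ext(2)])
    fix z :: complex assume z: "z \<in> circle"
    show "\<omega> z = mfun_scale (1 - s) (toeplitz n) z"
      using z car[OF z] T[OF z] \<omega>s[OF z] by (intro eq_matI) (auto simp: mfun_scale_def)
  qed (simp add: mfun_scale_def)
  ultimately show "\<exists>s\<in>{0..1}. \<theta> = mfun_scale s (toeplitz n) \<and> \<omega> = mfun_scale (1 - s) (toeplitz n)"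
    using s(1) by blast
qed

section \<open>Entanglement of the Toeplitz matrix\<close>

lemma trig_system_zero_at_one:
  assumes f: "f \<in> trig_system n" and zero: "\<And>z. z \<in> circle \<Longrightarrow> z \<noteq> 1 \<Longrightarrow> f z = 0"
  shows "f 1 = 0"
proof -
  obtain \<alpha> where \<alpha>: "\<And>z. z \<in> circle \<Longrightarrow> f z = (\<Sum>k = - int n + 1..int n - 1. \<alpha> k * z powi k)"
    using f by (auto simp: trig_system_def)
  have "\<alpha> k = 0" if "k \<in> {- int n + 1..int n - 1}" for k
  proof (rule laurent_coeffs_zero[of "circle - {1}" "{- int n + 1..int n - 1}"])
    show "infinite (circle - {1})"
      using infinite_circle by simp
  qed (use \<alpha> zero that in auto)
  then show ?thesis
    using \<alpha>[of 1] by simp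
qed

lemma toeplitz_not_separable:
  assumes n: "n \<ge> 2"
  shows "\<not> separable n n (toeplitz n)"
proof
  assume "separable n n (toeplitz n)"
  then obtain m :: nat and r s where
    r: "\<And>j. j \<in> {1..m} \<Longrightarrow> r j \<in> trig_system_pos n" and
    s: "\<And>j. j \<in> {1..m} \<Longrightarrow> s j \<in> psd_matrices n" and
    T: "toeplitz n = mfun_sum n (\<lambda>j. elem_tensor (r j) (s j)) {1..m}"
    unfolding separable_def by blast
  have car: "s j \<in> carrier_mat n n" if "j \<in> {1..m}" for j
    using s[OF that] by (simp add: psd_matrices_iff)
  have entry: "(\<Sum>i\<in>{1..m}. r i z * s i $$ (a, b)) = z ^ a * cnj (z ^ b)"
    if z: "z \<in> circle" and ab: "a < n" "b < n" for z a b
  proof -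
    have "toeplitz n z = finsum_mat n (\<lambda>j. r j z \<cdot>\<^sub>m s j) {1..m}"
      using z by (simp add: T mfun_sum_def elem_tensor_def)
    also have "\<dots> = mat n n (\<lambda>(a, b). \<Sum>i\<in>{1..m}. (r i z \<cdot>\<^sub>m s i) $$ (a, b))"
      using car by (intro finsum_mat_entries) auto
    finally have "toeplitz n z $$ (a, b) = (\<Sum>i\<in>{1..m}. (r i z \<cdot>\<^sub>m s i) $$ (a, b))"
      using ab by simp
    also have "\<dots> = (\<Sum>i\<in>{1..m}. r i z * s i $$ (a, b))"
      using carrier_matD[OF car] ab by (intro sum.cong) simp_all
    finally show ?thesis using toeplitz_entry[OF that] by simp
  qed
  have psd: "psd_form n (\<lambda>a b. r i z * s i $$ (a, b))" if "i \<in> {1..m}" "z \<in> circle" for i z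
    using r[OF that(1)] s[OF that(1)] that(2)
    by (intro psd_form_scale) (auto simp: trig_system_pos_def psd_matrices_iff)
  \<comment> \<open>The remaining terms again form a positive matrix, so each single term lies below
    the rank-one matrix at every \<open>z\<close>.\<close>
  have multiple: "r i z * s i $$ (a, b) = r i z * s i $$ (0, 0) * (z ^ a * cnj (z ^ b))"
    if i: "i \<in> {1..m}" and z: "z \<in> circle" and ab: "a < n" "b < n" for i z a b
  proof (rule psd_form_below_rank_one[OF psd[OF i z] _ _ _ ab])
    show "psd_form n (\<lambda>a b. \<Sum>l\<in>{1..m} - {i}. r l z * s l $$ (a, b))"
      using psd[OF _ z] by (intro psd_form_sum) auto
    fix a b assume "a < n" "b < n"
    with entry[OF z] show "r i z * s i $$ (a, b) + (\<Sum>l\<in>{1..m} - {i}. r l z * s l $$ (a, b))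
        = z ^ a * cnj (z ^ b)"
      using i by (subst sum.remove[symmetric]) auto
  qed simp
  have one: "(1::complex) \<in> circle" by simp
  have "(\<Sum>i\<in>{1..m}. r i 1 * s i $$ (0, 0)) \<noteq> 0"
    using entry[OF one, of 0 0] n by simp
  then obtain i where i: "i \<in> {1..m}" and "r i 1 * s i $$ (0, 0) \<noteq> 0"
    by (meson sum.neutral)
  then have nz: "r i 1 \<noteq> 0" "s i $$ (0, 0) \<noteq> 0" by auto
  \<comment> \<open>Here \<open>n \<ge> 2\<close> enters: row \<open>1\<close> exists. At
    \<open>z = 1\<close> the two entries of \<open>s i\<close> agree, while at any other
    \<open>z\<close> they would have to differ by the factor \<open>z\<close> unless
    \<open>r i z\<close> vanishes.\<close>
  have s10: "s i $$ (1, 0) = s i $$ (0, 0)"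
    using multiple[OF i one, of 1 0] n nz by simp
  have "r i z = 0" if "z \<in> circle" "z \<noteq> 1" for z
    using multiple[OF i that(1), of 1 0] n nz s10 that(2) by simp
  then have "r i 1 = 0"
    using r[OF i] trig_system_zero_at_one[of "r i" n] by (simp add: trig_system_pos_def)
  with nz show False by simp
qed

theorem theorem4p4:
  fixes n :: nat
  assumes "n \<ge> 2"
  shows "pure_in_cone mfun_add mfun_scale (trig_mat_cone n n) (toeplitz n)
    \<and> entangled n n (toeplitz n)"
  using assms toeplitz_pure[of n] toeplitz_in_cone toeplitz_not_separable
  by (simp add: entangled_def)

end
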